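(* Let $\Omega\subset\mathbb R^d$ ($d=2,3$) be the computational domain, $V^h\subset H^1(\Omega)$ the space of linear finite elements on a triangular (tetrahedral) mesh of $\Omega$, $m\ge1$, and let $\lambda_k$, $D^k$, $\widetilde D^k$ ($k=1,\dots,m$), $\widetilde K^m$ and $\boldsymbol g(\boldsymbol x,t)$ be as defined in the context. Let $\tau>0$ be the time step, $t_n=n\tau$, $\boldsymbol g^n=\boldsymbol g(\cdot,t_n)$, let $\sigma$ be the real weight parameter, and for any sequence write $y^{n+\sigma}=\sigma y^{n+1}+(1-\sigma)y^n$. Consider the two-level scheme: find $v^n\in V^h$ and $v_k^n\in V^h$, $k=1,\dots,m$, $n=0,1,\dots$, such that for all $z,z_1,\dots,z_m\in V^h$ and all $n=0,1,\dots$ $$\big(\widetilde K^m\nabla v^{n+\sigma},\nabla z\big)+\sum_{k=1}^m\big(D^k\nabla v_k^{n+\sigma},\nabla z\big)=\big(\boldsymbol g^{n+\sigma},\nabla z\big),$$ $$\Big(\widetilde D^k\nabla\frac{v_k^{n+1}-v_k^n}{\tau},\nabla z_k\Big)+\lambda_k\big(\widetilde D^k\nabla v_k^{n+\sigma},\nabla z_k\big)-\big(\widetilde D^k\nabla v^{n+\sigma},\nabla z_k\big)=0,\quad k=1,\dots,m,$$ with initial state determined by $$\big(\widetilde K^m\nabla v^0,\nabla z\big)=\big(\boldsymbol g^0,\nabla z\big),\qquad (v_k^0,z_k)=0,\quad k=1,\dots,m.$$ If the symmetric matrix $\widetilde K^m$ is positive definite, $\widetilde K^m>0$, and $\sigma\ge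 1/2$, then the scheme is unconditionally stable (i.e. stable without restriction on $\tau>0$): its solution satisfies, for every $N\ge1$ (with $T=N\tau$), the a priori estimate $$\tau\sum_{n=0}^{N-1}\big(\widetilde K^m\nabla v^{n+\sigma},\nabla v^{n+\sigma}\big)+\sum_{k=1}^m\big(D^k\nabla v_k^N,\nabla v_k^N\big)\le\tau\sum_{n=0}^{N-1}\big((\widetilde K^m)^{-1}\boldsymbol g^{n+\sigma},\boldsymbol g^{n+\sigma}\big).$$
   Context: In the claim, $(\cdot,\cdot)$ is the inner product of $L_2(\Omega)$ (for vector functions, $(\boldsymbol a,\boldsymbol b)=\int_\Omega \boldsymbol a\cdot\boldsymbol b\,d\boldsymbol x$). The function $v^n$ (approximate pressure) is determined up to an additive constant. Cell data. $Y=(0,1)^d$ is the periodicity cell, $Y=Y_f\cup Y_s\cup\Gamma$ with $Y_f$ the fluid part, $Y_s$ the solid part, $\Gamma=\partial Y_f\cap\partial Y_s$. The pairs $(\lambda_k,\boldsymbol\varphi_k)$, $k=1,2,\dots$, are the eigenvalues $0<\lambda_1\le\lambda_2\le\dots$ and $\boldsymbol L_2(Y_f)$-orthonormal eigenfunctions of the Stokes spectral problem $$-\Delta\boldsymbol\varphi+\nabla\eta=\lambda\boldsymbol\varphi,\quad \nabla\cdot\boldsymbol\varphi=0\ \text{ in } Y_f,\qquad \boldsymbol\varphi=0\ \text{ on }\Gamma,$$ with periodicity conditions on the cell. With $\boldsymbol e_i$ the Cartesian unit vectors, put $a_i^k=\int_{Y_f}\boldsymbol e_i\cdot\boldsymbol\varphi_k\,d\boldsymbol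 y$, $i=1,\dots,d$. Steady permeability tensor. $\bar K_{ij}=\int_{Y_f}\boldsymbol w_j^0\cdot\boldsymbol e_i\,d\boldsymbol y$, where $\boldsymbol w_j^0$ solves, with periodicity conditions, $$-\Delta\boldsymbol w_j^0+\nabla\pi_j=\boldsymbol e_j,\quad\nabla\cdot\boldsymbol w_j^0=0\ \text{ in }Y_f,\qquad \boldsymbol w_j^0=0\ \text{ on }\Gamma,\qquad j=1,\dots,d.$$ Constant $d\times d$ matrices: $D^k_{ij}=a_i^ka_j^k$ and $\widetilde D^k_{ij}=\frac{a_i^ka_j^k}{\lambda_k}$ for $k=1,\dots,m$, and $\widetilde K^m_{ij}=\bar K_{ij}-\sum_{k=1}^m\frac{a_i^ka_j^k}{\lambda_k}$. Right-hand side. $\boldsymbol f(\boldsymbol x)$ is a given time-independent body force on $\Omega$, and $\boldsymbol g(\boldsymbol x,t)=\bar K\boldsymbol f(\boldsymbol x)-\varPhi(t)\boldsymbol f(\boldsymbol x)$, where $\varPhi_{ij}(t)=\sum_{k=1}^m\frac{a_i^ka_j^k}{\lambda_k}\exp(-\lambda_kt)$. *)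

theory Defs
  imports "HOL-Analysis.Analysis"
begin

section \<open>Square-integrable functions\<close>

definition L2_space :: "'a::euclidean_space set \<Rightarrow> ('a \<Rightarrow> 'b::euclidean_space) set" where
  "L2_space S = {f. f \<in> borel_measurable (lebesgue_on S) \<and>
                    integrable (lebesgue_on S) (\<lambda>x. (norm (f x))\<^sup>2)}"

text \<open>For matrix-valued functions the inner product is the Frobenius one.\<close>

definition L2_inner ::
  "'a::euclidean_space set \<Rightarrow> ('a \<Rightarrow> 'b::euclidean_space) \<Rightarrow> ('a \<Rightarrow> 'b) \<Rightarrow> real" where
  "L2_inner S f g = (LINT x|lebesgue_on S. f x \<bullet> g x)"


section \<open>The periodicity cell and the Stokes problem in it\<close>

text \<open>The interface is \<open>frontier Yf \<inter> frontier Ys\<close>. It may meet the faces of the open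
  cell, hence the inclusion instead of an equation.\<close>

definition periodicity_cell :: "(real^'d) set \<Rightarrow> (real^'d) set \<Rightarrow> bool" where
  "periodicity_cell Yf Ys \<longleftrightarrow>
     open Yf \<and> open Ys \<and> Yf \<inter> Ys = {} \<and> Yf \<union> Ys \<subseteq> box 0 1 \<and>
     box 0 1 \<subseteq> Yf \<union> Ys \<union> (frontier Yf \<inter> frontier Ys)"

text \<open>The fluid region of the whole periodic medium, the complement of all integer translates
  of the closed solid part. It also contains those points on the faces of the cells across
  which fluid is connected; its intersection with \<open>box 0 1\<close> is \<open>Yf\<close>.\<close>

definition periodic_fluid :: "(real^'d) set \<Rightarrow> (real^'d) set" where
  "periodic_fluid Ys = {x. \<forall>z. (\<forall>i. z $ i \<in> \<int>) \<longrightarrow> x - z \<notin> closure Ys}"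

definition C1_periodic_test :: "(real^'d) set \<Rightarrow> (real^'d \<Rightarrow> real^'d) \<Rightarrow> bool" where
  "C1_periodic_test Ys \<psi> \<longleftrightarrow>
     (\<forall>x. \<psi> differentiable (at x)) \<and>
     continuous_on UNIV (\<lambda>x. jacobian \<psi> (at x)) \<and>
     (\<forall>x i. \<psi> (x + axis i 1) = \<psi> x) \<and>
     closure {x. \<psi> x \<noteq> 0} \<subseteq> periodic_fluid Ys"

text \<open>\<open>cell_H1 Yf Ys u G\<close>: the field \<open>u\<close> is in the Sobolev space of periodic \<open>H\<^sup>1\<close>
  vector fields on \<open>Yf\<close> which vanish on the interface, and \<open>G\<close> is its (weak) Jacobian matrix.
  As usual, the space is the closure, in the \<open>H\<^sup>1(Yf)\<close> norm, of the differentiable periodic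
  fields supported away from the solid part (\<open>C\<^sup>1\<close> fields and smooth ones have the same
  closure).\<close>

definition cell_H1 ::
  "(real^'d) set \<Rightarrow> (real^'d) set \<Rightarrow> (real^'d \<Rightarrow> real^'d) \<Rightarrow> (real^'d \<Rightarrow> real^'d^'d) \<Rightarrow> bool" where
  "cell_H1 Yf Ys u G \<longleftrightarrow>
     u \<in> L2_space Yf \<and> G \<in> L2_space Yf \<and>
     (\<exists>\<psi>. (\<forall>n::nat. C1_periodic_test Ys (\<psi> n)) \<and>
          (\<lambda>n. LINT x|lebesgue_on Yf. (norm (\<psi> n x - u x))\<^sup>2) \<longlonglongrightarrow> 0 \<and>
          (\<lambda>n. LINT x|lebesgue_on Yf. (norm (jacobian (\<psi> n) (at x) - G x))\<^sup>2) \<longlonglongrightarrow> 0)"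

text \<open>The field \<open>u\<close> is a weak solution of \<open>-\<Delta>u + \<nabla>p = F\<close>, \<open>\<nabla>\<cdot>u = 0\<close> in the fluid, with
  \<open>u = 0\<close> on the interface and periodicity conditions. Testing with periodic fields, which need
  not vanish on the faces of the cell, includes the periodicity of \<open>p\<close> and of the fluxes.\<close>

definition cell_stokes_solution ::
  "(real^'d) set \<Rightarrow> (real^'d) set \<Rightarrow> (real^'d \<Rightarrow> real^'d) \<Rightarrow> (real^'d \<Rightarrow> real^'d) \<Rightarrow> bool" where
  "cell_stokes_solution Yf Ys F u \<longleftrightarrow>
     (\<exists>G p. cell_H1 Yf Ys u G \<and> p \<in> L2_space Yf \<and>
        (AE x in lebesgue_on Yf. trace (G x) = 0) \<and>
        (\<forall>\<psi> H. cell_H1 Yf Ys \<psi> H \<longrightarrow>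
           L2_inner Yf G H - L2_inner Yf p (\<lambda>x. trace (H x)) = L2_inner Yf F \<psi>))"

text \<open>The eigenvalues are enumerated from index 1 with their multiplicities: the last clause
  states that no eigenvalue and no eigenfunction is missing.\<close>

definition cell_stokes_spectrum ::
  "(real^'d) set \<Rightarrow> (real^'d) set \<Rightarrow> (nat \<Rightarrow> real) \<Rightarrow> (nat \<Rightarrow> real^'d \<Rightarrow> real^'d) \<Rightarrow> bool" where
  "cell_stokes_spectrum Yf Ys ev \<phi> \<longleftrightarrow>
     (\<forall>k\<ge>1. 0 < ev k \<and> ev k \<le> ev (Suc k)) \<and>
     (\<forall>k\<ge>1. cell_stokes_solution Yf Ys (\<lambda>y. ev k *\<^sub>R \<phi> k y) (\<phi> k)) \<and>
     (\<forall>j\<ge>1. \<forall>k\<ge>1. L2_inner Yf (\<phi> j) (\<phi> k) = (if j = k then 1 else 0)) \<and>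
     (\<forall>\<mu> u. cell_stokes_solution Yf Ys (\<lambda>y. \<mu> *\<^sub>R u y) u \<longrightarrow>
        (\<exists>S c. finite S \<and> S \<subseteq> {k. k \<ge> 1 \<and> ev k = \<mu>} \<and>
               (AE y in lebesgue_on Yf. u y = (\<Sum>k\<in>S. c k *\<^sub>R \<phi> k y))))"


section \<open>Linear finite elements\<close>

definition simplicial_mesh :: "(real^'d) set \<Rightarrow> (real^'d) set set \<Rightarrow> bool" where
  "simplicial_mesh \<Omega> \<T> \<longleftrightarrow>
     triangulation \<T> \<and> (\<forall>T\<in>\<T>. int CARD('d) simplex T) \<and> \<Union>\<T> = closure \<Omega>"

text \<open>Finite element functions are total functions here; their values outside
  \<open>closure \<Omega>\<close> play no role.\<close>

definition linear_fe_space :: "(real^'d) set \<Rightarrow> (real^'d) set set \<Rightarrow> (real^'d \<Rightarrow> real) set" where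
  "linear_fe_space \<Omega> \<T> =
     {v. continuous_on (closure \<Omega>) v \<and> (\<forall>T\<in>\<T>. \<exists>a b. \<forall>x\<in>T. v x = a \<bullet> x + b)}"

text \<open>The classical gradient. A finite element function is differentiable outside the
  negligible union of the element boundaries, and there its gradient is its weak
  gradient.\<close>

definition grad :: "(real^'d \<Rightarrow> real) \<Rightarrow> real^'d \<Rightarrow> real^'d" where
  "grad v x = (\<chi> i. frechet_derivative v (at x) (axis i 1))"

definition pos_definite :: "real^'d^'d \<Rightarrow> bool" where
  "pos_definite A \<longleftrightarrow> (\<forall>x. x \<noteq> 0 \<longrightarrow> 0 < (A *v x) \<bullet> x)"

text \<open>The value \<open>y\<close> at level \<open>n + \<sigma>\<close>.\<close>

definition weighted :: "real \<Rightarrow> (nat \<Rightarrow> 'a \<Rightarrow> 'b::real_vector) \<Rightarrow> nat \<Rightarrow> 'a \<Rightarrow> 'b" where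
  "weighted \<sigma> y n = (\<lambda>x. \<sigma> *\<^sub>R y (Suc n) x + (1 - \<sigma>) *\<^sub>R y n x)"

text \<open>\<open>(A \<nabla>u, \<nabla>z)\<close>\<close>

definition grad_form ::
  "(real^'d) set \<Rightarrow> real^'d^'d \<Rightarrow> (real^'d \<Rightarrow> real) \<Rightarrow> (real^'d \<Rightarrow> real) \<Rightarrow> real" where
  "grad_form \<Omega> A u z = L2_inner \<Omega> (\<lambda>x. A *v grad u x) (grad z)"

end

theory Submission
  imports Defs
begin

text \<open>The estimate is an energy identity. The first equation is tested with
  \<open>z = v\<^sup>n\<^sup>+\<^sup>\<sigma>\<close> and the equation for \<open>v\<^sub>k\<close>, multiplied by \<open>\<lambda>\<^sub>k\<close>, with
  \<open>z\<^sub>k = v\<^sub>k\<^sup>n\<^sup>+\<^sup>\<sigma>\<close>. Since \<open>D\<^sup>k\<close> is \<open>\<lambda>\<^sub>k\<close> times the matrix of that equation, the coupling terms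
  \<open>(D\<^sup>k \<nabla>v\<^sub>k, \<nabla>v)\<close> cancel on addition. What remains on the left is
  \<open>(Kt \<nabla>v, \<nabla>v)\<close>, the nonnegative terms \<open>\<lambda>\<^sub>k (D\<^sup>k \<nabla>v\<^sub>k, \<nabla>v\<^sub>k)\<close> and the time differences, which
  for \<open>\<sigma> \<ge> 1/2\<close> dominate half the increment of the energies \<open>(D\<^sup>k \<nabla>v\<^sub>k, \<nabla>v\<^sub>k)\<close>
  (\<open>weighted_step_energy\<close>); on the right is \<open>(g, \<nabla>v)\<close>, which Young's inequality in the metric
  of \<open>Kt\<close> (\<open>pos_definite_young\<close>) splits into half of \<open>(Kt \<nabla>v, \<nabla>v)\<close> and half of
  \<open>(Kt\<inverse> g, g)\<close>. The increments telescope, and the initial energies vanish.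

  Young's inequality needs \<open>Kt\<close> to be symmetric. The only part of it for which this is not
  visible is the steady permeability tensor, whose entries are the Dirichlet products of the cell
  solutions (\<open>permeability_symmetric\<close>).

  The scheme works with classical gradients of finite element functions. These are linear in the
  function only almost everywhere, namely inside the elements, where the functions are affine;
  the element boundaries form a null set. This, together with the square integrability of the
  gradients (\<open>grad_L2\<close>), makes the forms \<open>grad_form\<close> bilinear on the finite element space.\<close>

section \<open>The space of square-integrable functions\<close>

lemma L2_integrable_inner:
  assumes "f \<in> L2_space S" "g \<in> L2_space S"
  shows "integrable (lebesgue_on S) (\<lambda>x. f x \<bullet> g x)"
proof (rule Bochner_Integration.integrable_bound)
  have [measurable]: "f \<in> borel_measurable (lebesgue_on S)" "g \<in> borel_measurable (lebesgue_on S)"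
    using assms by (auto simp: L2_space_def)
  show "integrable (lebesgue_on S) (\<lambda>x. (norm (f x))\<^sup>2 + (norm (g x))\<^sup>2)"
    using assms by (auto simp: L2_space_def)
  show "(\<lambda>x. f x \<bullet> g x) \<in> borel_measurable (lebesgue_on S)"
    by measurable
  have "norm (f x \<bullet> g x) \<le> norm ((norm (f x))\<^sup>2 + (norm (g x))\<^sup>2)" for x
  proof -
    have "\<bar>f x \<bullet> g x\<bar> \<le> norm (f x) * norm (g x)"
      by (rule Cauchy_Schwarz_ineq2)
    moreover have "2 * (norm (f x) * norm (g x)) \<le> (norm (f x))\<^sup>2 + (norm (g x))\<^sup>2"
      using sum_squares_bound[of "norm (f x)" "norm (g x)"] by simp
    moreover have "0 \<le> norm (f x) * norm (g x)"
      by simp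
    ultimately show ?thesis
      by simp
  qed
  then show "AE x in lebesgue_on S.
      norm (f x \<bullet> g x) \<le> norm ((norm (f x))\<^sup>2 + (norm (g x))\<^sup>2)"
    by simp
qed

lemma L2_space_bounded_linear:
  assumes f: "f \<in> L2_space S" and h: "bounded_linear h"
  shows "(\<lambda>x. h (f x)) \<in> L2_space S"
proof -
  obtain B where B: "norm (h y) \<le> norm y * B" for y
    using bounded_linear.bounded[OF h] by blast
  have f_meas [measurable]: "f \<in> borel_measurable (lebesgue_on S)"
    using f by (auto simp: L2_space_def)
  have "h \<in> borel_measurable borel"
    using h by (simp add: borel_measurable_continuous_onI linear_continuous_on)
  then have hf [measurable]: "(\<lambda>x. h (f x)) \<in> borel_measurable (lebesgue_on S)"
    by measurable
  have "integrable (lebesgue_on S) (\<lambda>x. (norm (h (f x)))\<^sup>2)"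
  proof (rule Bochner_Integration.integrable_bound)
    show "integrable (lebesgue_on S) (\<lambda>x. B\<^sup>2 * (norm (f x))\<^sup>2)"
      using f by (auto simp: L2_space_def)
    have "(norm (h (f x)))\<^sup>2 \<le> (norm (f x) * B)\<^sup>2" for x
      by (intro power_mono B) simp
    then show "AE x in lebesgue_on S.
        norm ((norm (h (f x)))\<^sup>2) \<le> norm (B\<^sup>2 * (norm (f x))\<^sup>2)"
      by (simp add: power_mult_distrib mult.commute)
  qed measurable
  then show ?thesis
    using hf by (simp add: L2_space_def)
qed

lemma L2_inner_commute: "L2_inner S f g = L2_inner S g f"
  by (simp add: L2_inner_def inner_commute)


section \<open>Positive definite symmetric matrices\<close>

lemma symmetric_matrix_inner:
  fixes A :: "real^'n^'n"
  assumes "transpose A = A"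
  shows "(A *v x) \<bullet> y = x \<bullet> (A *v y)"
  by (metis assms dot_lmul_matrix transpose_matrix_vector)

lemma pos_definite_matrix_inv_right:
  assumes "pos_definite A"
  shows "A *v (matrix_inv A *v y) = y"
proof -
  have "inj ((*v) A)"
  proof (rule injI)
    fix x y assume "A *v x = A *v y"
    then have "A *v (x - y) = 0"
      by (simp add: matrix_vector_mult_diff_distrib)
    then show "x = y"
      using assms by (metis inner_zero_left less_irrefl pos_definite_def right_minus_eq)
  qed
  then have "invertible A"
    by (simp add: invertible_left_inverse matrix_left_invertible_injective)
  then have "A ** matrix_inv A = mat 1"
    unfolding invertible_def matrix_inv_def by (metis (mono_tags, lifting) someI_ex)
  then show ?thesis
    by (simp add: matrix_vector_mul_assoc)
qed

text \<open>Expand \<open>(A (x - r)) \<bullet> (x - r) \<ge> 0\<close> for the minimiser \<open>r = A\<inverse> y\<close> of the quadratic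
  functional \<open>(A x) \<bullet> x - 2 (y \<bullet> x)\<close>. Symmetry of \<open>A\<close> makes the two cross terms equal.\<close>

lemma pos_definite_young:
  assumes sym: "transpose A = A" and pos: "pos_definite A"
  shows "2 * (y \<bullet> x) \<le> (A *v x) \<bullet> x + (matrix_inv A *v y) \<bullet> y"
proof -
  define r where "r = matrix_inv A *v y"
  have Ar: "A *v r = y"
    unfolding r_def by (rule pos_definite_matrix_inv_right[OF pos])
  have "0 \<le> (A *v (x - r)) \<bullet> (x - r)"
    using pos unfolding pos_definite_def by (cases "x - r = 0") (auto intro: less_imp_le)
  also have "\<dots> = (A *v x) \<bullet> x - (A *v x) \<bullet> r - y \<bullet> x + y \<bullet> r"
    by (simp add: matrix_vector_mult_diff_distrib Ar inner_diff_left inner_diff_right)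
  also have "(A *v x) \<bullet> r = y \<bullet> x"
    using symmetric_matrix_inner[OF sym, of x r] by (simp add: Ar inner_commute)
  finally show ?thesis
    by (simp add: r_def inner_commute)
qed

lemma rank_one_matrix_vector_inner:
  fixes c :: "'n::finite \<Rightarrow> real"
  shows "((\<chi> i j. c i * c j) *v x) \<bullet> y = ((\<chi> i. c i) \<bullet> x) * ((\<chi> i. c i) \<bullet> y)"
proof -
  have "(\<chi> i j. c i * c j) *v x = ((\<chi> i. c i) \<bullet> x) *\<^sub>R (\<chi> i. c i)"
    by (simp add: vec_eq_iff matrix_vector_mult_def inner_vec_def sum_distrib_left mult_ac)
  then show ?thesis
    by simp
qed


section \<open>The permeability tensor is symmetric\<close>

text \<open>Testing the problem for \<open>w\<^sub>j\<close> with \<open>w\<^sub>i\<close> removes the pressure, because \<open>w\<^sub>i\<close> is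
  solenoidal, and expresses the entry as the symmetric product of the two Jacobians.\<close>

lemma permeability_symmetric:
  assumes w: "\<And>j. cell_stokes_solution Yf Ys (\<lambda>y. axis j 1) (w j)"
  shows "L2_inner Yf (w j) (\<lambda>y. axis i 1) = L2_inner Yf (w i) (\<lambda>y. axis j 1)"
proof -
  have "\<exists>G p. cell_H1 Yf Ys (w j) G \<and> (AE x in lebesgue_on Yf. trace (G x) = 0) \<and>
      (\<forall>\<psi> H. cell_H1 Yf Ys \<psi> H \<longrightarrow> L2_inner Yf G H
          - L2_inner Yf p (\<lambda>x. trace (H x)) = L2_inner Yf (\<lambda>y. axis j 1) \<psi>)" for j
    using w[of j] unfolding cell_stokes_solution_def by blast
  then obtain G p where G: "cell_H1 Yf Ys (w j) (G j)"
      and div: "AE x in lebesgue_on Yf. trace (G j x) = 0"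
      and eq: "cell_H1 Yf Ys \<psi> H \<Longrightarrow> L2_inner Yf (G j) H
          - L2_inner Yf (p j) (\<lambda>x. trace (H x)) = L2_inner Yf (\<lambda>y. axis j 1) \<psi>"
    for j \<psi> H
    by metis
  have "L2_inner Yf (G j) (G i) = L2_inner Yf (w i) (\<lambda>y. axis j 1)" for i j
  proof -
    have "L2_inner Yf (p j) (\<lambda>x. trace (G i x)) = 0"
      unfolding L2_inner_def by (rule integral_eq_zero_AE) (use div[of i] in auto)
    then show ?thesis
      using eq[OF G, of j i] by (simp add: L2_inner_commute)
  qed
  then show ?thesis
    by (metis L2_inner_commute)
qed


section \<open>Gradients of finite element functions\<close>

lemma linear_fe_space_lincomb:
  assumes "u \<in> linear_fe_space \<Omega> \<T>" "v \<in> linear_fe_space \<Omega> \<T>"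
  shows "(\<lambda>x. c * u x + d * v x) \<in> linear_fe_space \<Omega> \<T>"
proof -
  have "\<exists>a b. \<forall>x\<in>T. c * u x + d * v x = a \<bullet> x + b" if "T \<in> \<T>" for T
  proof -
    obtain a1 b1 a2 b2 where "\<forall>x\<in>T. u x = a1 \<bullet> x + b1" "\<forall>x\<in>T. v x = a2 \<bullet> x + b2"
      using assms \<open>T \<in> \<T>\<close> unfolding linear_fe_space_def by blast
    then have "c * u x + d * v x = (c *\<^sub>R a1 + d *\<^sub>R a2) \<bullet> x + (c * b1 + d * b2)"
      if "x \<in> T" for x
      using that by (simp add: inner_add_left distrib_left)
    then show ?thesis
      by (intro exI ballI)
  qed
  moreover have "continuous_on (closure \<Omega>) (\<lambda>x. c * u x + d * v x)"
    using assms by (intro continuous_intros) (simp_all add: linear_fe_space_def)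
  ultimately show ?thesis
    unfolding linear_fe_space_def by (intro CollectI conjI ballI)
qed

lemma has_derivative_on_interior_of_affine_piece:
  assumes "\<forall>x\<in>T. u x = a \<bullet> x + b" and "x \<in> interior T"
  shows "(u has_derivative (\<lambda>h. a \<bullet> h)) (at x)"
proof (rule has_derivative_transform_within_open)
  show "((\<lambda>x. a \<bullet> x + b) has_derivative (\<lambda>h. a \<bullet> h)) (at x)"
    by (auto intro!: derivative_eq_intros)
  show "open (interior T)" "x \<in> interior T"
    using assms(2) by auto
  show "\<And>y. y \<in> interior T \<Longrightarrow> a \<bullet> y + b = u y"
    using assms(1) interior_subset by (metis subsetD)
qed

lemma grad_eqI:
  assumes "(u has_derivative (\<lambda>h. a \<bullet> h)) (at x)"
  shows "grad u x = a"
  unfolding grad_def frechet_derivative_at[OF assms, symmetric]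
  by (simp add: vec_eq_iff inner_axis)

text \<open>Elements are convex, so their finitely many frontiers are null sets.\<close>

lemma AE_in_element_interior:
  assumes mesh: "simplicial_mesh \<Omega> \<T>" and \<Omega>: "open \<Omega>"
  shows "AE x in lebesgue_on \<Omega>. x \<in> (\<Union>T\<in>\<T>. interior T)"
proof -
  have fin: "finite \<T>" and T: "\<And>T. T \<in> \<T> \<Longrightarrow> int CARD('a) simplex T"
    and cover: "\<Union>\<T> = closure \<Omega>"
    using mesh by (auto simp: simplicial_mesh_def triangulation_def)
  have "convex T" if "T \<in> \<T>" for T
    using T[OF that] by (metis polytope_imp_convex simplex_imp_polytope)
  then have "negligible (\<Union>T\<in>\<T>. frontier T)"
    by (intro negligible_Union finite_imageI fin) (auto intro: negligible_convex_frontier)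
  then have "(\<Union>T\<in>\<T>. frontier T) \<in> null_sets lebesgue"
    by (simp add: negligible_iff_null_sets)
  moreover have "x \<in> (\<Union>T\<in>\<T>. frontier T)" if "x \<in> \<Omega>" "x \<notin> (\<Union>T\<in>\<T>. interior T)" for x
  proof -
    obtain T where "T \<in> \<T>" "x \<in> T"
      using cover \<open>x \<in> \<Omega>\<close> closure_subset by blast
    then show ?thesis
      using that(2) closure_subset by (auto simp: frontier_def)
  qed
  ultimately have "AE x in lebesgue. x \<in> \<Omega> \<longrightarrow> x \<in> (\<Union>T\<in>\<T>. interior T)"
    by (intro AE_I'[of "\<Union>T\<in>\<T>. frontier T"]) auto
  then show ?thesis
    using \<Omega> by (subst AE_restrict_space_iff) auto
qed

lemma linear_fe_space_slopes:
  assumes "u \<in> linear_fe_space \<Omega> \<T>"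
  obtains s where "\<And>T x. T \<in> \<T> \<Longrightarrow> x \<in> interior T \<Longrightarrow> (u has_derivative (\<lambda>h. s T \<bullet> h)) (at x)"
proof -
  have "\<forall>T\<in>\<T>. \<exists>a b. \<forall>x\<in>T. u x = a \<bullet> x + b"
    using assms by (simp add: linear_fe_space_def)
  then obtain s b where "\<And>T x. T \<in> \<T> \<Longrightarrow> x \<in> T \<Longrightarrow> u x = s T \<bullet> x + b T"
    by metis
  then show thesis
    by (intro that[of s] has_derivative_on_interior_of_affine_piece) auto
qed

lemma AE_grad_lincomb:
  assumes mesh: "simplicial_mesh \<Omega> \<T>" and \<Omega>: "open \<Omega>"
    and u: "u \<in> linear_fe_space \<Omega> \<T>" and v: "v \<in> linear_fe_space \<Omega> \<T>"
  shows "AE x in lebesgue_on \<Omega>. grad (\<lambda>x. c * u x + d * v x) x = c *\<^sub>R grad u x + d *\<^sub>R grad v x"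
  using AE_in_element_interior[OF mesh \<Omega>]
proof (rule AE_mp, intro AE_I2 impI)
  fix x assume "x \<in> (\<Union>T\<in>\<T>. interior T)"
  then obtain T where T: "T \<in> \<T>" "x \<in> interior T" by blast
  obtain s r where
    s: "(u has_derivative (\<lambda>h. s T \<bullet> h)) (at x)" and r: "(v has_derivative (\<lambda>h. r T \<bullet> h)) (at x)"
    using linear_fe_space_slopes[OF u] linear_fe_space_slopes[OF v] T by metis
  have "((\<lambda>x. c * u x + d * v x) has_derivative (\<lambda>h. (c *\<^sub>R s T + d *\<^sub>R r T) \<bullet> h)) (at x)"
    using s r by (auto intro!: derivative_eq_intros simp: inner_add_left)
  then show "grad (\<lambda>x. c * u x + d * v x) x = c *\<^sub>R grad u x + d *\<^sub>R grad v x"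
    using s r by (simp add: grad_eqI)
qed

text \<open>On the union of the element interiors, an open set of full measure, the gradient is locally
  constant, hence continuous and measurable. It takes finitely many values there and \<open>\<Omega>\<close> has
  finite measure.\<close>

lemma grad_L2:
  assumes mesh: "simplicial_mesh \<Omega> \<T>" and \<Omega>: "open \<Omega>" "bounded \<Omega>"
    and u: "u \<in> linear_fe_space \<Omega> \<T>"
  shows "grad u \<in> L2_space \<Omega>"
proof -
  define R where "R = (\<Union>T\<in>\<T>. interior T)"
  obtain s where s: "\<And>T x. T \<in> \<T> \<Longrightarrow> x \<in> interior T \<Longrightarrow> (u has_derivative (\<lambda>h. s T \<bullet> h)) (at x)"
    using linear_fe_space_slopes[OF u] by blast
  have grad: "grad u x = s T" if "T \<in> \<T>" "x \<in> interior T" for T x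
    by (rule grad_eqI[OF s[OF that]])
  have R: "open R" "AE x in lebesgue_on \<Omega>. x \<in> R"
    unfolding R_def using AE_in_element_interior[OF mesh \<Omega>(1)] by auto
  have "isCont (grad u) x" if "x \<in> R" for x
  proof -
    obtain T where T: "T \<in> \<T>" "x \<in> interior T"
      using \<open>x \<in> R\<close> by (auto simp: R_def)
    have "\<forall>\<^sub>F y in nhds x. grad u y = s T"
      using T grad by (auto simp: eventually_nhds intro!: exI[of _ "interior T"])
    then show ?thesis
      by (subst isCont_cong) auto
  qed
  then have "continuous_on R (grad u)"
    by (simp add: continuous_at_imp_continuous_on)
  then have "grad u \<in> borel_measurable (lebesgue_on R)"
    using R(1) by (intro continuous_imp_measurable_on_sets_lebesgue) auto
  then have "(\<lambda>x. if x \<in> R then grad u x else 0) \<in> borel_measurable lebesgue"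
    using R(1) by (intro borel_measurable_if_I) auto
  then have "(\<lambda>x. if x \<in> \<Omega> then (if x \<in> R then grad u x else 0) else 0) \<in> borel_measurable lebesgue"
    by (rule borel_measurable_if_I[OF measurable_restrict_space1]) (use \<Omega>(1) in auto)
  moreover have "AE x in lebesgue. (if x \<in> \<Omega> then (if x \<in> R then grad u x else 0) else 0)
      = (if x \<in> \<Omega> then grad u x else 0)"
    using R(2) \<Omega>(1) by (subst (asm) AE_restrict_space_iff) auto
  \<comment> \<open>Completeness of the Lebesgue measure makes the unknown values on the element boundaries
     harmless for measurability.\<close>
  ultimately have "(\<lambda>x. if x \<in> \<Omega> then grad u x else 0) \<in> borel_measurable lebesgue"
    by (rule borel_measurable_AE)
  then have meas [measurable]: "grad u \<in> borel_measurable (lebesgue_on \<Omega>)"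
    using \<Omega>(1) by (subst (asm) borel_measurable_if) auto
  have fin: "finite \<T>"
    using mesh by (auto simp: simplicial_mesh_def triangulation_def)
  interpret finite_measure "lebesgue_on \<Omega>"
    using \<Omega> by (intro finite_measure_lebesgue_on lmeasurable_open)
  have "integrable (lebesgue_on \<Omega>) (\<lambda>x. (norm (grad u x))\<^sup>2)"
  proof (rule integrable_const_bound[where B = "\<Sum>T\<in>\<T>. (norm (s T))\<^sup>2"])
    have "norm ((norm (grad u x))\<^sup>2) \<le> (\<Sum>T\<in>\<T>. (norm (s T))\<^sup>2)" if "x \<in> R" for x
    proof -
      obtain T where T: "T \<in> \<T>" "x \<in> interior T"
        using \<open>x \<in> R\<close> by (auto simp: R_def)
      then show ?thesis
        using member_le_sum[of T \<T> "\<lambda>T. (norm (s T))\<^sup>2"] fin by (simp add: grad)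
    qed
    then show "AE x in lebesgue_on \<Omega>. norm ((norm (grad u x))\<^sup>2) \<le> (\<Sum>T\<in>\<T>. (norm (s T))\<^sup>2)"
      using R(2) by auto
  qed measurable
  then show ?thesis
    using meas by (simp add: L2_space_def)
qed

text \<open>The initial condition for \<open>v\<^sub>k\<close> says, with \<open>v\<^sub>k\<close> itself as test function, that its \<open>L\<^sub>2\<close> norm
  vanishes. A continuous function which is zero almost everywhere on an open set is zero on all
  of it, as a nonempty open set is not negligible.\<close>

lemma grad_eq_0_if_L2_norm_eq_0:
  assumes \<Omega>: "open \<Omega>" "bounded \<Omega>" and cont: "continuous_on (closure \<Omega>) u"
    and norm: "L2_inner \<Omega> u u = 0" and x: "x \<in> \<Omega>"
  shows "grad u x = 0"
proof -
  have cont_sq: "continuous_on (closure \<Omega>) (\<lambda>x. u x \<bullet> u x)"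
    by (intro continuous_intros cont)
  have "compact (closure \<Omega>)"
    using \<Omega>(2) by simp
  then have "bounded ((\<lambda>x. u x \<bullet> u x) ` closure \<Omega>)"
    by (intro compact_imp_bounded compact_continuous_image cont_sq)
  then obtain B where B: "\<And>x. x \<in> closure \<Omega> \<Longrightarrow> norm (u x \<bullet> u x) \<le> B"
    by (auto simp: bounded_iff)
  interpret finite_measure "lebesgue_on \<Omega>"
    using \<Omega> by (intro finite_measure_lebesgue_on lmeasurable_open)
  have "integrable (lebesgue_on \<Omega>) (\<lambda>x. u x \<bullet> u x)"
  proof (rule integrable_const_bound[where B = B])
    show "AE x in lebesgue_on \<Omega>. norm (u x \<bullet> u x) \<le> B"
      using B closure_subset by (intro AE_I2) (auto simp: subset_iff)
    show "(\<lambda>x. u x \<bullet> u x) \<in> borel_measurable (lebesgue_on \<Omega>)"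
      using \<Omega>(1) continuous_on_subset[OF cont_sq closure_subset]
      by (intro continuous_imp_measurable_on_sets_lebesgue) auto
  qed
  then have "AE x in lebesgue_on \<Omega>. u x \<bullet> u x = 0"
    using norm integral_nonneg_eq_0_iff_AE[of "lebesgue_on \<Omega>" "\<lambda>x. u x \<bullet> u x"]
    by (simp add: L2_inner_def)
  then have "AE x in lebesgue. x \<in> \<Omega> \<longrightarrow> u x = 0"
    using \<Omega>(1) by (subst (asm) AE_restrict_space_iff) auto
  then have "{x \<in> \<Omega>. u x \<noteq> 0} \<in> null_sets lebesgue"
    by (simp add: completion.AE_iff_null_sets conj_commute)
  moreover have "open {x \<in> \<Omega>. u x \<noteq> 0}"
  proof -
    have "open (\<Omega> \<inter> u -` (- {0}))"
      using continuous_on_subset[OF cont closure_subset] \<Omega>(1)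
      by (auto intro!: continuous_open_preimage)
    also have "\<Omega> \<inter> u -` (- {0}) = {x \<in> \<Omega>. u x \<noteq> 0}" by auto
    finally show ?thesis .
  qed
  ultimately have "{x \<in> \<Omega>. u x \<noteq> 0} = {}"
    using open_not_negligible negligible_iff_null_sets by blast
  then have zero: "0 = u y" if "y \<in> \<Omega>" for y
    using that by auto
  have "(u has_derivative (\<lambda>h. 0 \<bullet> h)) (at x)"
    by (rule has_derivative_transform_within_open[OF _ \<Omega>(1) x zero]) auto
  then show ?thesis
    by (rule grad_eqI)
qed


section \<open>The bilinear forms of the scheme\<close>

lemma grad_form_lincomb_left:
  assumes mesh: "simplicial_mesh \<Omega> \<T>" and \<Omega>: "open \<Omega>" "bounded \<Omega>"
    and u: "u \<in> linear_fe_space \<Omega> \<T>" and v: "v \<in> linear_fe_space \<Omega> \<T>"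
    and z: "z \<in> linear_fe_space \<Omega> \<T>"
  shows "grad_form \<Omega> A (\<lambda>x. c * u x + d * v x) z = c * grad_form \<Omega> A u z + d * grad_form \<Omega> A v z"
proof -
  note L2 = grad_L2[OF mesh \<Omega>]
  have A: "(\<lambda>x. A *v h x) \<in> L2_space \<Omega>" if "h \<in> L2_space \<Omega>" for h
    using that by (rule L2_space_bounded_linear) simp
  note int = L2_integrable_inner[OF A[OF L2[OF u]] L2[OF z]]
    L2_integrable_inner[OF A[OF L2[OF v]] L2[OF z]]
    L2_integrable_inner[OF A[OF L2[OF linear_fe_space_lincomb[OF u v]]] L2[OF z]]
  have "grad_form \<Omega> A (\<lambda>x. c * u x + d * v x) z
      = (LINT x|lebesgue_on \<Omega>. c * ((A *v grad u x) \<bullet> grad z x) + d * ((A *v grad v x) \<bullet> grad z x))"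
    unfolding grad_form_def L2_inner_def
  proof (rule integral_cong_AE)
    show "AE x in lebesgue_on \<Omega>. (A *v grad (\<lambda>x. c * u x + d * v x) x) \<bullet> grad z x
        = c * ((A *v grad u x) \<bullet> grad z x) + d * ((A *v grad v x) \<bullet> grad z x)"
      using AE_grad_lincomb[OF mesh \<Omega>(1) u v, of c d]
      by (rule AE_mp, intro AE_I2 impI)
        (simp add: matrix_vector_right_distrib matrix_vector_mult_scaleR inner_add_left)
  qed (use int in \<open>auto intro!: borel_measurable_integrable\<close>)
  also have "\<dots> = c * grad_form \<Omega> A u z + d * grad_form \<Omega> A v z"
    unfolding grad_form_def L2_inner_def using int by simp
  finally show ?thesis .
qed

lemma grad_form_commute:
  assumes "transpose A = A"
  shows "grad_form \<Omega> A u z = grad_form \<Omega> A z u"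
proof -
  have "(A *v grad u x) \<bullet> grad z x = (A *v grad z x) \<bullet> grad u x" for x
    by (rule trans[OF symmetric_matrix_inner[OF assms] inner_commute])
  then show ?thesis
    unfolding grad_form_def L2_inner_def by presburger
qed

lemma grad_form_nonneg:
  assumes "\<And>x. 0 \<le> (A *v x) \<bullet> x"
  shows "0 \<le> grad_form \<Omega> A u u"
  unfolding grad_form_def L2_inner_def by (rule Bochner_Integration.integral_nonneg) (use assms in auto)

text \<open>With \<open>b\<close> for the form, \<open>p\<close>, \<open>q\<close> for the new and the old level and \<open>\<delta> = p - q\<close>, the
  difference of the two sides is \<open>(2 * \<sigma> - 1) * b \<delta> \<delta>\<close>, because the weighted value is
  \<open>(p + q) / 2 + (\<sigma> - 1/2) * \<delta>\<close>. This is where \<open>\<sigma> \<ge> 1/2\<close> enters.\<close>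

lemma weighted_step_energy:
  assumes mesh: "simplicial_mesh \<Omega> \<T>" and \<Omega>: "open \<Omega>" "bounded \<Omega>"
    and y: "\<And>n. y n \<in> linear_fe_space \<Omega> \<T>"
    and A: "transpose A = A" "\<And>x. 0 \<le> (A *v x) \<bullet> x" and \<sigma>: "\<sigma> \<ge> 1/2"
  shows "grad_form \<Omega> A (y (Suc n)) (y (Suc n)) - grad_form \<Omega> A (y n) (y n)
      \<le> 2 * grad_form \<Omega> A (\<lambda>x. y (Suc n) x - y n x) (weighted \<sigma> y n)"
proof -
  define b where "b = grad_form \<Omega> A"
  have lin: "b (\<lambda>x. c * u x + d * v x) z = c * b u z + d * b v z"
    if "u \<in> linear_fe_space \<Omega> \<T>" "v \<in> linear_fe_space \<Omega> \<T>" "z \<in> linear_fe_space \<Omega> \<T>"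
    for c d u v z
    unfolding b_def by (rule grad_form_lincomb_left[OF mesh \<Omega> that])
  have sym: "b u z = b z u" for u z
    unfolding b_def by (rule grad_form_commute[OF A(1)])
  define p q \<delta> where "p = y (Suc n)" and "q = y n" and "\<delta> = (\<lambda>x. 1 * p x + (-1) * q x)"
  have pq: "p \<in> linear_fe_space \<Omega> \<T>" "q \<in> linear_fe_space \<Omega> \<T>"
    unfolding p_def q_def by (rule y)+
  then have "\<delta> \<in> linear_fe_space \<Omega> \<T>"
    unfolding \<delta>_def by (rule linear_fe_space_lincomb)
  note V = pq this
  have W: "b \<delta> (weighted \<sigma> y n) = \<sigma> * b p \<delta> + (1 - \<sigma>) * b q \<delta>"
    using lin[OF V(1,2,3), of \<sigma> "1 - \<sigma>"] by (simp add: weighted_def p_def q_def sym[of \<delta>])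
  have \<delta>: "b p \<delta> = b p p - b p q" "b q \<delta> = b p q - b q q" "b \<delta> \<delta> = b p \<delta> - b q \<delta>"
    using lin[OF pq V(1), of 1 "-1"] lin[OF pq V(2), of 1 "-1"] lin[OF pq V(3), of 1 "-1"]
      sym[of p q] sym[of p \<delta>] sym[of q \<delta>]
    unfolding \<delta>_def[symmetric] by linarith+
  have "0 \<le> (2 * \<sigma> - 1) * b \<delta> \<delta>"
    using \<sigma> grad_form_nonneg[OF A(2), of \<Omega> \<delta>] by (simp add: b_def)
  then have "b p p - b q q \<le> 2 * b \<delta> (weighted \<sigma> y n)"
    unfolding W \<delta> by (simp add: algebra_simps)
  moreover have "\<delta> = (\<lambda>x. y (Suc n) x - y n x)"
    by (simp add: \<delta>_def p_def q_def)
  ultimately show ?thesis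
    by (simp only: b_def p_def q_def)
qed


section \<open>The a priori estimate\<close>

theorem theorem2:
  fixes Yf Ys \<Omega> :: "(real^'d) set"
    and ev :: "nat \<Rightarrow> real" and \<phi> :: "nat \<Rightarrow> real^'d \<Rightarrow> real^'d"
    and w :: "'d \<Rightarrow> real^'d \<Rightarrow> real^'d"
    and a :: "'d \<Rightarrow> nat \<Rightarrow> real"
    and K Kt :: "real^'d^'d" and D Dt :: "nat \<Rightarrow> real^'d^'d" and \<Phi> :: "real \<Rightarrow> real^'d^'d"
    and \<T> :: "(real^'d) set set" and Vh :: "(real^'d \<Rightarrow> real) set"
    and f :: "real^'d \<Rightarrow> real^'d" and g :: "real \<Rightarrow> real^'d \<Rightarrow> real^'d"
    and gn :: "nat \<Rightarrow> real^'d \<Rightarrow> real^'d"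
    and m :: nat and \<tau> \<sigma> :: real
    and v :: "nat \<Rightarrow> real^'d \<Rightarrow> real" and vk :: "nat \<Rightarrow> nat \<Rightarrow> real^'d \<Rightarrow> real"
  assumes dim: "CARD('d) = 2 \<or> CARD('d) = 3"
    and cell: "periodicity_cell Yf Ys"
    and spectrum: "cell_stokes_spectrum Yf Ys ev \<phi>"
    and a: "\<forall>i k. a i k = L2_inner Yf (\<lambda>y. axis i 1) (\<phi> k)"
    and w: "\<forall>j. cell_stokes_solution Yf Ys (\<lambda>y. axis j 1) (w j)"
    and K: "K = (\<chi> i j. L2_inner Yf (w j) (\<lambda>y. axis i 1))"
    and m: "m \<ge> 1"
    and D: "\<forall>k. D k = (\<chi> i j. a i k * a j k)"
    and Dt: "\<forall>k. Dt k = (\<chi> i j. a i k * a j k / ev k)"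
    and Kt: "Kt = (\<chi> i j. K $ i $ j - (\<Sum>k=1..m. a i k * a j k / ev k))"
    and \<Phi>: "\<forall>t. \<Phi> t = (\<chi> i j. \<Sum>k=1..m. a i k * a j k / ev k * exp (- ev k * t))"
    and domain: "open \<Omega>" "connected \<Omega>" "bounded \<Omega>" "\<Omega> \<noteq> {}"
    and mesh: "simplicial_mesh \<Omega> \<T>"
    and Vh: "Vh = linear_fe_space \<Omega> \<T>"
    and f: "f \<in> L2_space \<Omega>"
    and g: "\<forall>t x. g t x = K *v f x - \<Phi> t *v f x"
    and \<tau>: "\<tau> > 0"
    and gn: "\<forall>n. gn n = g (real n * \<tau>)"
    and v: "\<forall>n. v n \<in> Vh"
    and vk: "\<forall>k\<in>{1..m}. \<forall>n. vk k n \<in> Vh"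
    and scheme: "\<forall>n. \<forall>z\<in>Vh.
        grad_form \<Omega> Kt (weighted \<sigma> v n) z
        + (\<Sum>k=1..m. grad_form \<Omega> (D k) (weighted \<sigma> (vk k) n) z)
        = L2_inner \<Omega> (weighted \<sigma> gn n) (grad z)"
    and scheme_k: "\<forall>n. \<forall>k\<in>{1..m}. \<forall>z\<in>Vh.
        grad_form \<Omega> (Dt k) (\<lambda>x. (vk k (Suc n) x - vk k n x) / \<tau>) z
        + ev k * grad_form \<Omega> (Dt k) (weighted \<sigma> (vk k) n) z
        - grad_form \<Omega> (Dt k) (weighted \<sigma> v n) z = 0"
    and initial: "\<forall>z\<in>Vh. grad_form \<Omega> Kt (v 0) z = L2_inner \<Omega> (gn 0) (grad z)"
    and initial_k: "\<forall>k\<in>{1..m}. \<forall>z\<in>Vh. L2_inner \<Omega> (vk k 0) z = 0"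
    and Kt_pos: "pos_definite Kt"
    and \<sigma>: "\<sigma> \<ge> 1/2"
  shows "\<forall>N\<ge>1.
      \<tau> * (\<Sum>n<N. grad_form \<Omega> Kt (weighted \<sigma> v n) (weighted \<sigma> v n))
      + (\<Sum>k=1..m. grad_form \<Omega> (D k) (vk k N) (vk k N))
      \<le> \<tau> * (\<Sum>n<N. L2_inner \<Omega> (\<lambda>x. matrix_inv Kt *v weighted \<sigma> gn n x) (weighted \<sigma> gn n))"
proof -
  have \<Omega>: "open \<Omega>" "bounded \<Omega>" by fact+
  note fe = mesh \<Omega>
  have ev: "ev k > 0" if "k \<in> {1..m}" for k
    using spectrum that by (auto simp: cell_stokes_spectrum_def)
  have D_inner: "(D k *v x) \<bullet> y = ((\<chi> i. a i k) \<bullet> x) * ((\<chi> i. a i k) \<bullet> y)" for k x y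
    using rank_one_matrix_vector_inner[of "\<lambda>i. a i k"] by (simp add: D)
  have D_sym: "transpose (D k) = D k" for k
    by (simp add: D transpose_def mult.commute)
  have D_nonneg: "0 \<le> (D k *v x) \<bullet> x" for k x
    by (simp add: D_inner)
  have D_Dt: "grad_form \<Omega> (D k) u z = ev k * grad_form \<Omega> (Dt k) u z" if "k \<in> {1..m}" for k u z
  proof -
    have "D k = ev k *\<^sub>R Dt k"
      using ev[OF that] by (simp add: D Dt vec_eq_iff)
    then show ?thesis
      by (simp add: grad_form_def L2_inner_def scaleR_matrix_vector_assoc[symmetric])
  qed
  have Kt_sym: "transpose Kt = Kt"
  proof -
    have "K $ i $ j = K $ j $ i" for i j
      using permeability_symmetric[of Yf Ys w] w by (simp add: K)
    then show ?thesis
      by (simp add: Kt transpose_def vec_eq_iff mult.commute)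
  qed
  define V where "V n = weighted \<sigma> v n" for n
  define W where "W k n = weighted \<sigma> (vk k) n" for k n
  define G where "G n = weighted \<sigma> gn n" for n
  define S where "S n = (\<Sum>k=1..m. grad_form \<Omega> (D k) (vk k n) (vk k n))" for n
  define E where "E n = grad_form \<Omega> Kt (V n) (V n)" for n
  define F where "F n = L2_inner \<Omega> (\<lambda>x. matrix_inv Kt *v G n x) (G n)" for n
  have V: "V n \<in> linear_fe_space \<Omega> \<T>" for n
    using v unfolding V_def weighted_def Vh by (auto intro!: linear_fe_space_lincomb)
  have W: "W k n \<in> linear_fe_space \<Omega> \<T>" if "k \<in> {1..m}" for k n
    using vk that unfolding W_def weighted_def Vh by (auto intro!: linear_fe_space_lincomb)
  have G: "G n \<in> L2_space \<Omega>" for n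
  proof -
    define M where "M = \<sigma> *\<^sub>R (K - \<Phi> (real (Suc n) * \<tau>)) + (1 - \<sigma>) *\<^sub>R (K - \<Phi> (real n * \<tau>))"
    have "G n = (\<lambda>x. M *v f x)"
      by (simp add: G_def weighted_def gn g M_def matrix_vector_mult_add_rdistrib
          matrix_vector_mult_diff_rdistrib scaleR_matrix_vector_assoc[symmetric] fun_eq_iff)
    then show ?thesis
      using L2_space_bounded_linear[OF f, of "(*v) M"] by simp
  qed

  \<comment> \<open>The equation for \<open>v\<^sub>k\<close>, multiplied by \<open>ev k\<close> and tested with the weighted value;
     the nonnegative dissipation term is dropped.\<close>
  have memory: "grad_form \<Omega> (D k) (vk k (Suc n)) (vk k (Suc n)) - grad_form \<Omega> (D k) (vk k n) (vk k n)
      \<le> 2 * \<tau> * grad_form \<Omega> (D k) (W k n) (V n)" if k: "k \<in> {1..m}" for k n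
  proof -
    let ?\<delta> = "\<lambda>x. vk k (Suc n) x - vk k n x"
    have mem: "vk k i \<in> linear_fe_space \<Omega> \<T>" for i
      using vk k Vh by simp
    have "grad_form \<Omega> (Dt k) (\<lambda>x. ?\<delta> x / \<tau>) (W k n)
        + ev k * grad_form \<Omega> (Dt k) (W k n) (W k n) - grad_form \<Omega> (Dt k) (V n) (W k n) = 0"
      using scheme_k k W[OF k] unfolding W_def V_def Vh by blast
    then have "ev k * (grad_form \<Omega> (Dt k) (\<lambda>x. ?\<delta> x / \<tau>) (W k n)
        + ev k * grad_form \<Omega> (Dt k) (W k n) (W k n) - grad_form \<Omega> (Dt k) (V n) (W k n)) = 0"
      by simp
    then have eq: "grad_form \<Omega> (D k) (\<lambda>x. ?\<delta> x / \<tau>) (W k n)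
        + ev k * grad_form \<Omega> (D k) (W k n) (W k n) = grad_form \<Omega> (D k) (W k n) (V n)"
      unfolding grad_form_commute[OF D_sym, of \<Omega> k "W k n" "V n"]
      by (simp add: D_Dt[OF k] algebra_simps)
    have \<delta>: "grad_form \<Omega> (D k) (\<lambda>x. ?\<delta> x / \<tau>) (W k n) = grad_form \<Omega> (D k) ?\<delta> (W k n) / \<tau>"
      using grad_form_lincomb_left[OF fe mem[of "Suc n"] mem[of n] W[OF k], of "D k" "1 / \<tau>" "- 1 / \<tau>"]
        grad_form_lincomb_left[OF fe mem[of "Suc n"] mem[of n] W[OF k], of "D k" 1 "-1"]
      by (simp add: diff_divide_distrib)
    have "0 \<le> ev k * grad_form \<Omega> (D k) (W k n) (W k n)"
      using ev[OF k] grad_form_nonneg[OF D_nonneg] by simp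
    then have "grad_form \<Omega> (D k) ?\<delta> (W k n) / \<tau> \<le> grad_form \<Omega> (D k) (W k n) (V n)"
      using eq \<delta> by linarith
    then have "2 * grad_form \<Omega> (D k) ?\<delta> (W k n) \<le> 2 * \<tau> * grad_form \<Omega> (D k) (W k n) (V n)"
      using \<tau> by (simp add: pos_divide_le_eq mult.commute)
    then show ?thesis
      using weighted_step_energy[where y = "vk k", OF fe mem D_sym D_nonneg \<sigma>, of k n] unfolding W_def by linarith
  qed

  have young: "2 * L2_inner \<Omega> (G n) (grad (V n)) \<le> E n + F n" for n
  proof -
    note GV = grad_L2[OF fe V[of n]]
    note lin = L2_space_bounded_linear[OF _ matrix_vector_mul_bounded_linear]
    note int = L2_integrable_inner[OF G[of n] GV] L2_integrable_inner[OF lin[OF GV] GV]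
      L2_integrable_inner[OF lin[OF G[of n]] G[of n]]
    have "(LINT x|lebesgue_on \<Omega>. 2 * (G n x \<bullet> grad (V n) x))
        \<le> (LINT x|lebesgue_on \<Omega>. (Kt *v grad (V n) x) \<bullet> grad (V n) x
            + (matrix_inv Kt *v G n x) \<bullet> G n x)"
      by (intro integral_mono integrable_mult_right Bochner_Integration.integrable_add int
          pos_definite_young[OF Kt_sym Kt_pos])
    then show ?thesis
      using int by (simp add: E_def F_def grad_form_def L2_inner_def)
  qed

  have step: "\<tau> * E n + S (Suc n) \<le> \<tau> * F n + S n" for n
  proof -
    have "S (Suc n) - S n \<le> (\<Sum>k=1..m. 2 * \<tau> * grad_form \<Omega> (D k) (W k n) (V n))"
      unfolding S_def sum_subtractf[symmetric] by (rule sum_mono) (rule memory)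
    also have "\<dots> = 2 * \<tau> * (L2_inner \<Omega> (G n) (grad (V n)) - E n)"
    proof -
      have "E n + (\<Sum>k=1..m. grad_form \<Omega> (D k) (W k n) (V n)) = L2_inner \<Omega> (G n) (grad (V n))"
        using scheme V[of n] unfolding E_def V_def W_def G_def Vh by blast
      then show ?thesis
        by (simp add: sum_distrib_left[symmetric])
    qed
    also have "\<dots> \<le> \<tau> * (F n - E n)"
      using mult_left_mono[OF young[of n], of \<tau>] \<tau> by (simp add: algebra_simps)
    finally show ?thesis
      by (simp add: algebra_simps)
  qed

  have S0: "S 0 = 0"
  proof -
    have "grad_form \<Omega> (D k) (vk k 0) (vk k 0) = 0" if k: "k \<in> {1..m}" for k
    proof -
      have mem: "vk k 0 \<in> linear_fe_space \<Omega> \<T>"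
        using vk k Vh by simp
      then have "grad (vk k 0) x = 0" if "x \<in> \<Omega>" for x
        using initial_k k that unfolding Vh
        by (intro grad_eq_0_if_L2_norm_eq_0[OF \<Omega>]) (auto simp: linear_fe_space_def)
      then show ?thesis
        unfolding grad_form_def L2_inner_def
        by (intro integral_eq_zero_AE AE_I2) simp
    qed
    then show ?thesis
      by (simp add: S_def)
  qed
  have "\<tau> * (\<Sum>n<N. E n) + S N \<le> \<tau> * (\<Sum>n<N. F n)" for N
  proof (induction N)
    case 0
    show ?case by (simp add: S0)
  next
    case (Suc N)
    then show ?case
      using step[of N] by (simp add: algebra_simps)
  qed
  then show ?thesis
    by (simp add: E_def F_def G_def V_def S_def)
qed

end
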